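(* There is a finitely generated structure which has no d-$\Sigma^0_2$ Scott sentence but which has a d-$\Sigma^0_2$ quasi Scott sentence.
   Context: Formulas are in $\mathcal{L}_{\omega_1\omega}$ with the hierarchy: $\Sigma^0_0=\Pi^0_0$ = finitary quantifier-free; $\Sigma^0_\alpha$ = countable disjunctions of $\exists\bar x\,\phi$ with $\phi\in\Pi^0_\beta$, $\beta<\alpha$; $\Pi^0_\alpha$ = countable conjunctions of $\forall\bar x\,\phi$ with $\phi\in\Sigma^0_\beta$, $\beta<\alpha$; d-$\Sigma^0_\alpha$ = conjunction of a $\Sigma^0_\alpha$ and a $\Pi^0_\alpha$ formula. A Scott sentence for a countable structure is an $\mathcal{L}_{\omega_1\omega}$ sentence whose only countable model up to isomorphism is that structure; a quasi Scott sentence for a finitely generated structure is an $\mathcal{L}_{\omega_1\omega}$ sentence whose only finitely generated model up to isomorphism is that structure. *)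

theory Defs
  imports "HOL-Library.Countable" "HOL-Library.Countable_Set_Type"
begin

section \<open>Structures in countable languages\<close>

text \<open>A countable first-order language: symbols are natural numbers, and a symbol belongs to the
  language, with arity \<open>n\<close>, iff it is mapped to \<open>Some n\<close>.  Constants are function symbols of
  arity 0.\<close>

record lang =
  fn_arity :: "nat \<Rightarrow> nat option"
  rel_arity :: "nat \<Rightarrow> nat option"

record 'a struct =
  univ :: "'a set"
  fn_int :: "nat \<Rightarrow> 'a list \<Rightarrow> 'a"
  rel_int :: "nat \<Rightarrow> 'a list \<Rightarrow> bool"

definition is_struct :: "lang \<Rightarrow> 'a struct \<Rightarrow> bool" where
  "is_struct L A \<longleftrightarrow> univ A \<noteq> {} \<and>
     (\<forall>f n xs. fn_arity L f = Some n \<longrightarrow> length xs = n \<longrightarrow> set xs \<subseteq> univ A \<longrightarrow> fn_int A f xs \<in> univ A)"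

definition isomorphic :: "lang \<Rightarrow> 'a struct \<Rightarrow> 'b struct \<Rightarrow> bool" where
  "isomorphic L A B \<longleftrightarrow> (\<exists>h. bij_betw h (univ A) (univ B) \<and>
     (\<forall>f n xs. fn_arity L f = Some n \<longrightarrow> length xs = n \<longrightarrow> set xs \<subseteq> univ A \<longrightarrow>
        h (fn_int A f xs) = fn_int B f (map h xs)) \<and>
     (\<forall>r n xs. rel_arity L r = Some n \<longrightarrow> length xs = n \<longrightarrow> set xs \<subseteq> univ A \<longrightarrow>
        (rel_int A r xs \<longleftrightarrow> rel_int B r (map h xs))))"

inductive_set generated :: "lang \<Rightarrow> 'a struct \<Rightarrow> 'a set \<Rightarrow> 'a set"
  for L :: lang and A :: "'a struct" and G :: "'a set" where
  base: "x \<in> G \<Longrightarrow> x \<in> generated L A G"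
| app: "fn_arity L f = Some n \<Longrightarrow> length xs = n \<Longrightarrow> (\<forall>x\<in>set xs. x \<in> generated L A G) \<Longrightarrow>
    fn_int A f xs \<in> generated L A G"

definition finitely_generated :: "lang \<Rightarrow> 'a struct \<Rightarrow> bool" where
  "finitely_generated L A \<longleftrightarrow> (\<exists>G. finite G \<and> G \<subseteq> univ A \<and> generated L A G = univ A)"


section \<open>Formulas of the infinitary logic with countable conjunctions and disjunctions\<close>

datatype tm = Var nat | App nat "tm list"

datatype fm =
    Eq tm tm
  | Rel nat "tm list"
  | Neg fm
  | CConj "fm cset"
  | CDisj "fm cset"
  | Exi nat fm
  | Uni nat fm

primrec wf_tm :: "lang \<Rightarrow> tm \<Rightarrow> bool" where
  "wf_tm L (Var x) \<longleftrightarrow> True"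
| "wf_tm L (App f ts) \<longleftrightarrow> fn_arity L f = Some (length ts) \<and> list_all id (map (wf_tm L) ts)"

primrec wf_fm :: "lang \<Rightarrow> fm \<Rightarrow> bool" where
  "wf_fm L (Eq s t) \<longleftrightarrow> wf_tm L s \<and> wf_tm L t"
| "wf_fm L (Rel r ts) \<longleftrightarrow> rel_arity L r = Some (length ts) \<and> (\<forall>t\<in>set ts. wf_tm L t)"
| "wf_fm L (Neg \<phi>) \<longleftrightarrow> wf_fm L \<phi>"
| "wf_fm L (CConj \<Phi>) \<longleftrightarrow> (\<forall>b\<in>rcset (cimage (wf_fm L) \<Phi>). b)"
| "wf_fm L (CDisj \<Phi>) \<longleftrightarrow> (\<forall>b\<in>rcset (cimage (wf_fm L) \<Phi>). b)"
| "wf_fm L (Exi x \<phi>) \<longleftrightarrow> wf_fm L \<phi>"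
| "wf_fm L (Uni x \<phi>) \<longleftrightarrow> wf_fm L \<phi>"

primrec tm_vars :: "tm \<Rightarrow> nat set" where
  "tm_vars (Var x) = {x}"
| "tm_vars (App f ts) = \<Union> (set (map tm_vars ts))"

primrec free_vars :: "fm \<Rightarrow> nat set" where
  "free_vars (Eq s t) = tm_vars s \<union> tm_vars t"
| "free_vars (Rel r ts) = (\<Union>t\<in>set ts. tm_vars t)"
| "free_vars (Neg \<phi>) = free_vars \<phi>"
| "free_vars (CConj \<Phi>) = \<Union> (rcset (cimage free_vars \<Phi>))"
| "free_vars (CDisj \<Phi>) = \<Union> (rcset (cimage free_vars \<Phi>))"
| "free_vars (Exi x \<phi>) = free_vars \<phi> - {x}"
| "free_vars (Uni x \<phi>) = free_vars \<phi> - {x}"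

text \<open>A subformula of a sentence has only finitely many free variables, since each of them is bound
  by one of the finitely many quantifiers above it; so no separate finiteness condition is needed.\<close>

definition sentence :: "lang \<Rightarrow> fm \<Rightarrow> bool" where
  "sentence L \<phi> \<longleftrightarrow> wf_fm L \<phi> \<and> free_vars \<phi> = {}"

primrec tm_val :: "'a struct \<Rightarrow> (nat \<Rightarrow> 'a) \<Rightarrow> tm \<Rightarrow> 'a" where
  "tm_val A v (Var x) = v x"
| "tm_val A v (App f ts) = fn_int A f (map (tm_val A v) ts)"

primrec sat :: "'a struct \<Rightarrow> fm \<Rightarrow> (nat \<Rightarrow> 'a) \<Rightarrow> bool" where
  "sat A (Eq s t) = (\<lambda>v. tm_val A v s = tm_val A v t)"
| "sat A (Rel r ts) = (\<lambda>v. rel_int A r (map (tm_val A v) ts))"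
| "sat A (Neg \<phi>) = (\<lambda>v. \<not> sat A \<phi> v)"
| "sat A (CConj \<Phi>) = (\<lambda>v. \<forall>P\<in>rcset (cimage (sat A) \<Phi>). P v)"
| "sat A (CDisj \<Phi>) = (\<lambda>v. \<exists>P\<in>rcset (cimage (sat A) \<Phi>). P v)"
| "sat A (Exi x \<phi>) = (\<lambda>v. \<exists>a\<in>univ A. sat A \<phi> (v(x := a)))"
| "sat A (Uni x \<phi>) = (\<lambda>v. \<forall>a\<in>univ A. sat A \<phi> (v(x := a)))"

definition models :: "'a struct \<Rightarrow> fm \<Rightarrow> bool" where
  "models A \<phi> \<longleftrightarrow> (\<forall>v. range v \<subseteq> univ A \<longrightarrow> sat A \<phi> v)"

lemma wf_tm_App: "wf_tm L (App f ts) \<longleftrightarrow> fn_arity L f = Some (length ts) \<and> (\<forall>t\<in>set ts. wf_tm L t)"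
  by (simp add: list_all_iff)

lemma wf_fm_CConj: "wf_fm L (CConj \<Phi>) \<longleftrightarrow> (\<forall>\<phi>\<in>rcset \<Phi>. wf_fm L \<phi>)"
  by (simp add: cimage.rep_eq)

lemma wf_fm_CDisj: "wf_fm L (CDisj \<Phi>) \<longleftrightarrow> (\<forall>\<phi>\<in>rcset \<Phi>. wf_fm L \<phi>)"
  by (simp add: cimage.rep_eq)

lemma free_vars_CConj: "free_vars (CConj \<Phi>) = (\<Union>\<phi>\<in>rcset \<Phi>. free_vars \<phi>)"
  by (simp add: cimage.rep_eq)

lemma free_vars_CDisj: "free_vars (CDisj \<Phi>) = (\<Union>\<phi>\<in>rcset \<Phi>. free_vars \<phi>)"
  by (simp add: cimage.rep_eq)

lemma sat_CConj: "sat A (CConj \<Phi>) v \<longleftrightarrow> (\<forall>\<phi>\<in>rcset \<Phi>. sat A \<phi> v)"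
  by (simp add: cimage.rep_eq)

lemma sat_CDisj: "sat A (CDisj \<Phi>) v \<longleftrightarrow> (\<exists>\<phi>\<in>rcset \<Phi>. sat A \<phi> v)"
  by (simp add: cimage.rep_eq)


section \<open>The finite levels of the hierarchy\<close>

inductive fin_qf :: "fm \<Rightarrow> bool" where
  "fin_qf (Eq s t)"
| "fin_qf (Rel r ts)"
| "fin_qf \<phi> \<Longrightarrow> fin_qf (Neg \<phi>)"
| "finite (rcset \<Phi>) \<Longrightarrow> (\<forall>\<phi>\<in>rcset \<Phi>. fin_qf \<phi>) \<Longrightarrow> fin_qf (CConj \<Phi>)"
| "finite (rcset \<Phi>) \<Longrightarrow> (\<forall>\<phi>\<in>rcset \<Phi>. fin_qf \<phi>) \<Longrightarrow> fin_qf (CDisj \<Phi>)"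

inductive Sigma0 :: "nat \<Rightarrow> fm \<Rightarrow> bool" and Pi0 :: "nat \<Rightarrow> fm \<Rightarrow> bool" where
  Sigma0_zero: "fin_qf \<phi> \<Longrightarrow> Sigma0 0 \<phi>"
| Pi0_zero: "fin_qf \<phi> \<Longrightarrow> Pi0 0 \<phi>"
| Sigma0_pos: "0 < n \<Longrightarrow> (\<forall>\<psi>\<in>rcset \<Phi>. \<exists>xs \<phi> m. m < n \<and> Pi0 m \<phi> \<and> \<psi> = foldr Exi xs \<phi>) \<Longrightarrow>
    Sigma0 n (CDisj \<Phi>)"
| Pi0_pos: "0 < n \<Longrightarrow> (\<forall>\<psi>\<in>rcset \<Phi>. \<exists>xs \<phi> m. m < n \<and> Sigma0 m \<phi> \<and> \<psi> = foldr Uni xs \<phi>) \<Longrightarrow>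
    Pi0 n (CConj \<Phi>)"

definition dSigma0 :: "nat \<Rightarrow> fm \<Rightarrow> bool" where
  "dSigma0 n \<theta> \<longleftrightarrow> (\<exists>\<phi> \<psi>. Sigma0 n \<phi> \<and> Pi0 n \<psi> \<and> \<theta> = CConj (cinsert \<phi> (cinsert \<psi> cempty)))"


section \<open>Scott sentences\<close>

text \<open>Models range over structures whose universe is a set of natural numbers.  Up to isomorphism
  these are all countable (possibly finite) structures, and all finitely generated ones, as the
  lemmas \<open>countable_struct_iso_nat\<close> and \<open>finitely_generated_countable\<close> below show.\<close>

definition scott_sentence :: "lang \<Rightarrow> nat struct \<Rightarrow> fm \<Rightarrow> bool" where
  "scott_sentence L A \<phi> \<longleftrightarrow> sentence L \<phi> \<and> models A \<phi> \<and>
     (\<forall>B :: nat struct. is_struct L B \<longrightarrow> models B \<phi> \<longrightarrow> isomorphic L A B)"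

definition quasi_scott_sentence :: "lang \<Rightarrow> nat struct \<Rightarrow> fm \<Rightarrow> bool" where
  "quasi_scott_sentence L A \<phi> \<longleftrightarrow> sentence L \<phi> \<and> models A \<phi> \<and>
     (\<forall>B :: nat struct. is_struct L B \<longrightarrow> finitely_generated L B \<longrightarrow> models B \<phi> \<longrightarrow> isomorphic L A B)"

lemma countable_struct_iso_nat:
  fixes A :: "'a struct"
  assumes A: "is_struct L A" and c: "countable (univ A)"
  shows "\<exists>B :: nat struct. is_struct L B \<and> isomorphic L A B"
proof -
  obtain h :: "'a \<Rightarrow> nat" where h: "inj_on h (univ A)"
    using c by (auto simp: countable_def)
  define g where "g = inv_into (univ A) h"
  have gh: "g (h x) = x" if "x \<in> univ A" for x
    using that h by (simp add: g_def)
  have gU: "g y \<in> univ A" if "y \<in> h ` univ A" for y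
    using that gh by auto
  have mgh: "map g (map h xs) = xs" if "set xs \<subseteq> univ A" for xs
    using that gh by (induction xs) auto
  define B :: "nat struct" where
    "B = \<lparr>univ = h ` univ A, fn_int = (\<lambda>f xs. h (fn_int A f (map g xs))),
          rel_int = (\<lambda>r xs. rel_int A r (map g xs))\<rparr>"
  have "is_struct L B"
    unfolding is_struct_def
  proof (intro conjI allI impI)
    show "univ B \<noteq> {}" using A by (simp add: is_struct_def B_def)
    fix f n and xs :: "nat list"
    assume f: "fn_arity L f = Some n" "length xs = n" "set xs \<subseteq> univ B"
    have "set (map g xs) \<subseteq> univ A" using f(3) gU by (auto simp: B_def)
    then have "fn_int A f (map g xs) \<in> univ A"
      using A f(1,2) unfolding is_struct_def by (metis length_map)
    then show "fn_int B f xs \<in> univ B" by (simp add: B_def)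
  qed
  moreover have "isomorphic L A B"
    unfolding isomorphic_def
  proof (intro exI[of _ h] conjI allI impI)
    show "bij_betw h (univ A) (univ B)" using h by (simp add: B_def bij_betw_def)
  qed (simp_all add: B_def mgh del: map_map)
  ultimately show ?thesis by blast
qed

instance tm :: countable by countable_datatype

lemma finitely_generated_countable:
  assumes "finitely_generated L A"
  shows "countable (univ A)"
proof -
  obtain G where G: "finite G" "generated L A G = univ A"
    using assms unfolding finitely_generated_def by blast
  define v where "v = from_nat_into G"
  have "x \<in> range (tm_val A v)" if "x \<in> generated L A G" for x
    using that
  proof induction
    case (base x)
    then obtain i where "v i = x"
      unfolding v_def using G(1) by (metis countable_finite from_nat_into_surj)
    then show ?case by (metis rangeI tm_val.simps(1))
  next
    case (app f n xs)
    then have "\<exists>ts. xs = map (tm_val A v) ts"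
      by (intro ex_map_conv[THEN iffD2]) auto
    then show ?case by (metis rangeI tm_val.simps(2))
  qed
  then have "univ A \<subseteq> range (tm_val A v)" using G(2) by auto
  then show ?thesis by (rule countable_subset) simp
qed

end

theory Submission
  imports Defs
begin

text \<open>The structure is a tree whose language has the parent function and functions giving the \<open>n\<close>-th
  child of a node.  Its trunk \<open>a\<^sub>0, a\<^sub>1, a\<^sub>2, \<dots>\<close>, where \<open>a\<^sub>k\<^sub>+\<^sub>1\<close> is the parent of \<open>a\<^sub>k\<close>, consists of the
  nodes that are not the \<open>n\<close>-th child of their parent for any \<open>n\<close>, and \<open>a\<^sub>0\<close> generates everything.
  For large \<open>n\<close> the \<open>n\<close>-th child of \<open>a\<^sub>1\<close> is a finite approximation to \<open>a\<^sub>0\<close>, so the isomorphic copy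
  generated by \<open>a\<^sub>1\<close> is a proper \<open>\<Sigma>\<^sub>1\<close>-elementary substructure.  Hence the tree with trunk indexed by
  all integers, which is not finitely generated, satisfies the same d-\<open>\<Sigma>\<^sub>2\<close> sentences.  On the
  other hand, a d-\<open>\<Sigma>\<^sub>2\<close> sentence can say that the trunk is nonempty and a chain and that any two nodes
  have a common ancestor, so that every finite set of nodes is generated by one trunk node.  A
  finitely generated model is therefore generated by a trunk node and is isomorphic to the tree.\<close>

section \<open>Semantics of quantifier blocks and invariance under isomorphism\<close>

text \<open>A block acts as one simultaneous choice of values. Only \<open>set xs\<close> enters, so
  repeated variables in a block do no harm.\<close>

lemma sat_foldr_Exi:
  assumes "range v \<subseteq> univ A"
  shows "sat A (foldr Exi xs \<phi>) v \<longleftrightarrow>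
    (\<exists>u. range u \<subseteq> univ A \<and> (\<forall>i. i \<notin> set xs \<longrightarrow> u i = v i) \<and> sat A \<phi> u)"
  using assms
proof (induction xs arbitrary: v)
  case Nil
  have "u = v" if "\<forall>i. u i = v i" for u using that by auto
  then show ?case using Nil by auto
next
  case (Cons x xs)
  have r: "range (v(x := a)) \<subseteq> univ A" if "a \<in> univ A" for a
    using Cons.prems that by auto
  show ?case
  proof
    assume "sat A (foldr Exi (x # xs) \<phi>) v"
    then obtain a where a: "a \<in> univ A" "sat A (foldr Exi xs \<phi>) (v(x := a))" by auto
    with Cons.IH[OF r[OF a(1)]] obtain u where
      "range u \<subseteq> univ A" "\<forall>i. i \<notin> set xs \<longrightarrow> u i = (v(x := a)) i" "sat A \<phi> u" by blast
    then show "\<exists>u. range u \<subseteq> univ A \<and> (\<forall>i. i \<notin> set (x # xs) \<longrightarrow> u i = v i) \<and> sat A \<phi> u"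
      by (intro exI[of _ u]) auto
  next
    assume "\<exists>u. range u \<subseteq> univ A \<and> (\<forall>i. i \<notin> set (x # xs) \<longrightarrow> u i = v i) \<and> sat A \<phi> u"
    then obtain u where u: "range u \<subseteq> univ A" "\<forall>i. i \<notin> set (x # xs) \<longrightarrow> u i = v i" "sat A \<phi> u"
      by blast
    have ux: "u x \<in> univ A" using u(1) by auto
    have "sat A (foldr Exi xs \<phi>) (v(x := u x))"
      unfolding Cons.IH[OF r[OF ux]] using u by (intro exI[of _ u]) auto
    then show "sat A (foldr Exi (x # xs) \<phi>) v" using ux by auto
  qed
qed

lemma sat_foldr_Uni:
  assumes "range v \<subseteq> univ A"
  shows "sat A (foldr Uni xs \<phi>) v \<longleftrightarrow>
    (\<forall>u. range u \<subseteq> univ A \<longrightarrow> (\<forall>i. i \<notin> set xs \<longrightarrow> u i = v i) \<longrightarrow> sat A \<phi> u)"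
proof -
  have "sat A (foldr Uni xs \<phi>) v \<longleftrightarrow> \<not> sat A (foldr Exi xs (Neg \<phi>)) v"
    by (induction xs arbitrary: v) auto
  then show ?thesis unfolding sat_foldr_Exi[OF assms] sat.simps by blast
qed

lemma wf_fm_foldr_Exi [simp]: "wf_fm L (foldr Exi xs \<phi>) \<longleftrightarrow> wf_fm L \<phi>"
  by (induction xs) auto

lemma wf_fm_foldr_Uni [simp]: "wf_fm L (foldr Uni xs \<phi>) \<longleftrightarrow> wf_fm L \<phi>"
  by (induction xs) auto

lemma tm_val_in_univ:
  assumes "is_struct L A" "range v \<subseteq> univ A" "wf_tm L t"
  shows "tm_val A v t \<in> univ A"
  using assms(3)
proof (induction t)
  case (Var x)
  then show ?case using assms(2) by auto
next
  case (App f ts)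
  then have "set (map (tm_val A v) ts) \<subseteq> univ A" by (auto simp: wf_tm_App simp del: wf_tm.simps)
  then show ?case
    using assms(1) App.prems unfolding is_struct_def by simp
qed

text \<open>The map \<open>h\<close> is explicit, unlike in \<open>isomorphic\<close>, because
  valuations are carried along it. Well-formedness confines the formula to the symbols that
  \<open>h\<close> respects.\<close>

lemma sat_isomorphism:
  assumes A: "is_struct L A"
    and h: "bij_betw h (univ A) (univ B)"
    and fn: "\<And>f xs. fn_arity L f = Some (length xs) \<Longrightarrow> set xs \<subseteq> univ A \<Longrightarrow>
        h (fn_int A f xs) = fn_int B f (map h xs)"
    and rel: "\<And>r xs. rel_arity L r = Some (length xs) \<Longrightarrow> set xs \<subseteq> univ A \<Longrightarrow>
        rel_int A r xs \<longleftrightarrow> rel_int B r (map h xs)"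
    and "wf_fm L \<phi>" "range v \<subseteq> univ A"
  shows "sat A \<phi> v \<longleftrightarrow> sat B \<phi> (h \<circ> v)"
proof -
  have tm: "h (tm_val A v t) = tm_val B (h \<circ> v) t" if "wf_tm L t" "range v \<subseteq> univ A" for t v
    using that(1)
  proof (induction t)
    case (App f ts)
    have "set (map (tm_val A v) ts) \<subseteq> univ A"
      using App.prems tm_val_in_univ[OF A that(2)] by (auto simp: wf_tm_App simp del: wf_tm.simps)
    moreover have "map h (map (tm_val A v) ts) = map (tm_val B (h \<circ> v)) ts"
      using App by (simp add: wf_tm_App o_def del: wf_tm.simps)
    ultimately show ?case using fn[of f "map (tm_val A v) ts"] App.prems by (simp del: map_map o_apply)
  qed simp
  have upd: "h \<circ> v(x := a) = (h \<circ> v)(x := h a)" for v x a by auto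
  have U: "univ B = h ` univ A" using h by (simp add: bij_betw_def)
  have inj: "inj_on h (univ A)" using h by (simp add: bij_betw_def)
  show ?thesis
    using assms(5,6)
  proof (induction \<phi> arbitrary: v)
    case (Eq s t)
    have "tm_val A v s = tm_val A v t \<longleftrightarrow> h (tm_val A v s) = h (tm_val A v t)"
      using Eq tm_val_in_univ[OF A Eq.prems(2)] inj by (auto simp: inj_on_eq_iff)
    then show ?case using Eq tm by (simp del: o_apply)
  next
    case (Rel r ts)
    have "set (map (tm_val A v) ts) \<subseteq> univ A"
      using Rel.prems tm_val_in_univ[OF A Rel.prems(2)] by auto
    moreover have "map h (map (tm_val A v) ts) = map (tm_val B (h \<circ> v)) ts"
      using Rel.prems by (simp add: tm o_def)
    ultimately show ?case using rel[of r "map (tm_val A v) ts"] Rel.prems by (simp del: map_map o_apply)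
  next
    case (CConj \<Phi>)
    then show ?case by (auto simp: sat_CConj wf_fm_CConj simp del: sat.simps wf_fm.simps)
  next
    case (CDisj \<Phi>)
    then show ?case by (auto simp: sat_CDisj wf_fm_CDisj simp del: sat.simps wf_fm.simps)
  next
    case (Exi x \<phi>)
    have "sat A \<phi> (v(x := a)) \<longleftrightarrow> sat B \<phi> ((h \<circ> v)(x := h a))" if "a \<in> univ A" for a
    proof -
      have "range (v(x := a)) \<subseteq> univ A" using Exi.prems(2) that by auto
      then show ?thesis using Exi.IH[of "v(x := a)"] Exi.prems(1) by (simp only: upd wf_fm.simps)
    qed
    then show ?case by (auto simp: U simp del: o_apply)
  next
    case (Uni x \<phi>)
    have "sat A \<phi> (v(x := a)) \<longleftrightarrow> sat B \<phi> ((h \<circ> v)(x := h a))" if "a \<in> univ A" for a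
    proof -
      have "range (v(x := a)) \<subseteq> univ A" using Uni.prems(2) that by auto
      then show ?thesis using Uni.IH[of "v(x := a)"] Uni.prems(1) by (simp only: upd wf_fm.simps)
    qed
    then show ?case by (auto simp: U simp del: o_apply)
  qed auto
qed

lemma Sigma0_0_iff: "Sigma0 0 \<phi> \<longleftrightarrow> fin_qf \<phi>" and Pi0_0_iff: "Pi0 0 \<phi> \<longleftrightarrow> fin_qf \<phi>"
  by (auto elim: Sigma0.cases Pi0.cases intro: Sigma0_zero Pi0_zero)

lemma Sigma0_pos_E:
  assumes "Sigma0 n \<phi>" "0 < n"
  obtains \<Phi> where "\<phi> = CDisj \<Phi>"
    "\<And>\<psi>. \<psi> \<in> rcset \<Phi> \<Longrightarrow> \<exists>xs \<chi> m. m < n \<and> Pi0 m \<chi> \<and> \<psi> = foldr Exi xs \<chi>"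
  using assms by (auto elim: Sigma0.cases)

lemma Pi0_pos_E:
  assumes "Pi0 n \<phi>" "0 < n"
  obtains \<Phi> where "\<phi> = CConj \<Phi>"
    "\<And>\<psi>. \<psi> \<in> rcset \<Phi> \<Longrightarrow> \<exists>xs \<chi> m. m < n \<and> Sigma0 m \<chi> \<and> \<psi> = foldr Uni xs \<chi>"
  using assms by (auto elim: Pi0.cases)


section \<open>The trees\<close>

definition tree_lang :: lang where
  "tree_lang = \<lparr>fn_arity = (\<lambda>_. Some 1), rel_arity = (\<lambda>_. None)\<rparr>"

definition parent :: "'a struct \<Rightarrow> 'a \<Rightarrow> 'a" where
  "parent B x = fn_int B 0 [x]"

definition child :: "'a struct \<Rightarrow> nat \<Rightarrow> 'a \<Rightarrow> 'a" where
  "child B n x = fn_int B (Suc n) [x]"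

text \<open>Scott sentences are defined for \<open>nat struct\<close>, hence the coding by naturals.
  The head of \<open>w\<close> is the last child step taken, so a parent step removes the
  head.\<close>

definition node :: "int \<Rightarrow> nat list \<Rightarrow> nat" where
  "node k w = to_nat (k, w)"

definition tree_parent :: "nat \<Rightarrow> nat" where
  "tree_parent x = (case from_nat x of (k, []) \<Rightarrow> node (k + 1) [] | (k, n # w) \<Rightarrow> node k w)"

definition tree_child :: "nat \<Rightarrow> nat \<Rightarrow> nat" where
  "tree_child n x = (case from_nat x of (k, w) \<Rightarrow> node k (n # w))"

text \<open>The nodes \<open>node k []\<close> form the trunk: \<open>node (k + 1) []\<close> has, besides the children given by
  the functions of the language, the child \<open>node k []\<close> if \<open>k \<in> K\<close>.\<close>

definition tree :: "int set \<Rightarrow> nat struct" where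
  "tree K = \<lparr>univ = {node k w | k w. k \<in> K},
     fn_int = (\<lambda>f xs. case f of 0 \<Rightarrow> tree_parent (hd xs) | Suc n \<Rightarrow> tree_child n (hd xs)),
     rel_int = (\<lambda>_ _. False)\<rparr>"

lemma node_inject [simp]: "node k w = node k' w' \<longleftrightarrow> k = k' \<and> w = w'"
  by (simp add: node_def)

lemma from_nat_node [simp]: "from_nat (node k w) = (k, w)"
  by (simp add: node_def)

lemma univ_tree: "univ (tree K) = {node k w | k w. k \<in> K}"
  by (simp add: tree_def)

lemma node_in_tree [simp]: "node k w \<in> univ (tree K) \<longleftrightarrow> k \<in> K"
  by (auto simp: univ_tree)

lemma tree_parent_node [simp]:
  "tree_parent (node k []) = node (k + 1) []" "tree_parent (node k (n # w)) = node k w"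
  by (simp_all add: tree_parent_def)

lemma tree_child_node [simp]: "tree_child n (node k w) = node k (n # w)"
  by (simp add: tree_child_def)

lemma parent_tree [simp]: "parent (tree K) = tree_parent"
  by (simp add: parent_def tree_def fun_eq_iff)

lemma child_tree [simp]: "child (tree K) = tree_child"
  by (simp add: child_def tree_def fun_eq_iff)

section \<open>Closure of the trees, generation by one node, and non-isomorphism\<close>

lemma is_struct_tree_lang:
  "is_struct tree_lang B \<longleftrightarrow> univ B \<noteq> {} \<and>
     (\<forall>x\<in>univ B. parent B x \<in> univ B \<and> (\<forall>n. child B n x \<in> univ B))"
  (is "?l \<longleftrightarrow> ?r")
proof
  assume ?l
  then show ?r unfolding is_struct_def tree_lang_def parent_def child_def by auto
next
  assume r: ?r
  have "fn_int B f xs \<in> univ B" if "length xs = 1" "set xs \<subseteq> univ B" for f xs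
    using r that by (cases f) (auto simp: parent_def child_def length_Suc_conv)
  then show ?l using r by (auto simp: is_struct_def tree_lang_def)
qed

lemma is_struct_tree:
  assumes "K \<noteq> {}" "\<And>k. k \<in> K \<Longrightarrow> k + 1 \<in> K"
  shows "is_struct tree_lang (tree K)"
proof -
  have "tree_parent (node k w) \<in> univ (tree K)" if "k \<in> K" for k w
    using that assms(2) by (cases w) auto
  then show ?thesis
    using assms(1) by (auto simp: is_struct_tree_lang univ_tree)
qed

lemma is_struct_tree_atLeast: "is_struct tree_lang (tree {m..})"
  and is_struct_tree_UNIV: "is_struct tree_lang (tree UNIV)"
  by (rule is_struct_tree; force)+

text \<open>From \<open>node 0 []\<close>, parent steps climb through the whole trunk, and child
  steps then spell out every word.\<close>

lemma generated_tree: "generated tree_lang (tree {0..}) {node 0 []} = univ (tree {0..})"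
proof
  show "generated tree_lang (tree {0..}) {node 0 []} \<subseteq> univ (tree {0..})"
  proof
    fix x assume "x \<in> generated tree_lang (tree {0..}) {node 0 []}"
    then show "x \<in> univ (tree {0..})"
    proof induction
      case (app f n xs)
      then show ?case using is_struct_tree_atLeast[of 0] unfolding is_struct_def by blast
    qed auto
  qed
next
  let ?G = "generated tree_lang (tree {0..}) {node 0 []}"
  have fn: "fn_int (tree {0..}) f [x] \<in> ?G" if "x \<in> ?G" for f x
    using generated.app[of tree_lang f 1 "[x]" "tree {0..}"] that by (simp add: tree_lang_def)
  have p: "tree_parent x \<in> ?G" if "x \<in> ?G" for x
    using fn[OF that, of 0] by (simp add: tree_def)
  have c: "tree_child n x \<in> ?G" if "x \<in> ?G" for x n
    using fn[OF that, of "Suc n"] by (simp add: tree_def)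
  have t: "node (int j) [] \<in> ?G" for j
  proof (induction j)
    case (Suc j)
    then show ?case using p[OF Suc] by (simp add: add.commute)
  qed (auto intro: generated.base)
  have "node k w \<in> ?G" if "k \<ge> 0" for k w
  proof (induction w)
    case Nil
    then show ?case using t[of "nat k"] that by simp
  next
    case (Cons n w)
    then show ?case using c[OF Cons, of n] by simp
  qed
  then show "univ (tree {0..}) \<subseteq> ?G" by (auto simp: univ_tree)
qed

lemma finitely_generated_tree: "finitely_generated tree_lang (tree {0..})"
  unfolding finitely_generated_def using generated_tree by (intro exI[of _ "{node 0 []}"]) auto

text \<open>If the generator goes to \<open>node k w\<close>, the whole image stays in
  \<open>tree {k..}\<close>, which is closed under the functions, and so it misses
  \<open>node (k - 1) []\<close>.\<close>

lemma not_isomorphic_tree_UNIV: "\<not> isomorphic tree_lang (tree {0..}) (tree UNIV)"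
proof
  assume "isomorphic tree_lang (tree {0..}) (tree UNIV)"
  then obtain h where h: "bij_betw h (univ (tree {0..})) (univ (tree UNIV))"
    and fn: "\<And>f x. x \<in> univ (tree {0..}) \<Longrightarrow>
        h (fn_int (tree {0..}) f [x]) = fn_int (tree UNIV) f [h x]"
    unfolding isomorphic_def tree_lang_def by fastforce
  have im: "h ` univ (tree {0..}) = univ (tree UNIV)" using h by (simp add: bij_betw_def)
  then have "h (node 0 []) \<in> univ (tree UNIV)" by (rule subst) simp
  then obtain k w where kw: "h (node 0 []) = node k w" by (auto simp: univ_tree)
  have "x \<in> univ (tree {0..}) \<and> h x \<in> univ (tree {k..})"
    if "x \<in> generated tree_lang (tree {0..}) {node 0 []}" for x
    using that
  proof induction
    case (base x)
    then show ?case using kw by simp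
  next
    case (app f n xs)
    then obtain x where xs: "xs = [x]" by (auto simp: tree_lang_def length_Suc_conv)
    \<comment> \<open>The functions of a tree do not depend on the index set; only the universe
      does.\<close>
    have same: "fn_int (tree UNIV) f [h x] = fn_int (tree {k..}) f [h x]"
      by (simp add: tree_def)
    have cl: "fn_int (tree {m..}) f [y] \<in> univ (tree {m..})" if "y \<in> univ (tree {m..})" for y m
      using is_struct_tree_atLeast[of m] that unfolding is_struct_def tree_lang_def by simp
    show ?case using app xs cl fn[of x f] same by simp
  qed
  then have "h ` univ (tree {0..}) \<subseteq> univ (tree {k..})" unfolding generated_tree by auto
  moreover have "node (k - 1) [] \<in> h ` univ (tree {0..})" unfolding im by simp
  ultimately have "node (k - 1) [] \<in> univ (tree {k..})" by blast
  then show False by simp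
qed


section \<open>Existential elementarity\<close>

text \<open>The map sends the trunk node just below \<open>node m []\<close> to its \<open>N\<close>-th child.  It is a
  homomorphism, and it is injective on a given finite set as soon as \<open>N\<close> is large.\<close>

definition retract :: "int \<Rightarrow> nat \<Rightarrow> nat \<Rightarrow> nat" where
  "retract m N x = (case from_nat x of (k, w) \<Rightarrow>
     if m \<le> k then x else node m (w @ replicate (nat (m - k)) N))"

lemma retract_node:
  "retract m N (node k w) = (if m \<le> k then node k w else node m (w @ replicate (nat (m - k)) N))"
  by (simp add: retract_def)

lemma retract_id: "x \<in> univ (tree {m..}) \<Longrightarrow> retract m N x = x"
  by (auto simp: univ_tree retract_node)

lemma retract_in_tree: "x \<in> univ (tree UNIV) \<Longrightarrow> retract m N x \<in> univ (tree {m..})"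
  by (auto simp: univ_tree retract_node)

lemma retract_fn_int:
  assumes "x \<in> univ (tree UNIV)"
  shows "retract m N (fn_int (tree K) f [x]) = fn_int (tree K') f [retract m N x]"
proof -
  obtain k w where x: "x = node k w" using assms by (auto simp: univ_tree)
  show ?thesis
  proof (cases f)
    case 0
    show ?thesis
    proof (cases "w = [] \<and> k < m")
      case True
      \<comment> \<open>The critical case, a parent step along the trunk below \<open>m\<close>: on
        the image side it removes one copy of \<open>N\<close>, so the number of copies has to drop
        by exactly one.\<close>
      then have "nat (m - k) = Suc (nat (m - (k + 1)))" by linarith
      then show ?thesis using True by (simp add: tree_def x 0 retract_node)
    next
      case False
      then show ?thesis by (cases w) (auto simp: tree_def x 0 retract_node)
    qed
  next
    case (Suc n)
    then show ?thesis by (simp add: tree_def x retract_node)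
  qed
qed

lemma eventually_notin_set: "\<forall>\<^sub>F N in sequentially. (N :: nat) \<notin> set w"
  using eventually_gt_at_top[of "Max (insert 0 (set w))"]
  by eventually_elim (use Max_ge[of "insert 0 (set w)"] in force)

text \<open>The part before the first \<open>N\<close> recovers the word; comparing lengths then
  recovers the exponent.\<close>

lemma append_replicate_cancel:
  assumes "N \<notin> set w" "N \<notin> set w'" "w @ replicate p N = w' @ replicate p' N"
  shows "w = w' \<and> p = p'"
proof -
  have *: "takeWhile (\<lambda>x. x \<noteq> N) (u @ replicate q N) = u" if "N \<notin> set u" for u q
    using that by (induction u) (auto simp: takeWhile_replicate)
  have "w = w'" using *[OF assms(1), of p] *[OF assms(2), of p'] assms(3) by simp
  then show ?thesis using arg_cong[OF assms(3), of length] by simp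
qed

text \<open>Take \<open>N\<close> outside both words. Two moved nodes with equal images coincide by
  \<open>append_replicate_cancel\<close>, and a moved node differs from an unmoved one by the
  occurrence of \<open>N\<close>.\<close>

lemma eventually_retract_inject:
  assumes "x \<in> univ (tree UNIV)" "y \<in> univ (tree UNIV)"
  shows "\<forall>\<^sub>F N in sequentially. retract m N x = retract m N y \<longleftrightarrow> x = y"
proof -
  obtain k w k' w' where x: "x = node k w" and y: "y = node k' w'"
    using assms by (auto simp: univ_tree)
  show ?thesis
    using eventually_notin_set[of w] eventually_notin_set[of w']
  proof eventually_elim
    case (elim N)
    have mem: "N \<in> set (u @ replicate (nat (m - j)) N)" if "j < m" for u j using that by simp
    show ?case
      using elim append_replicate_cancel[OF elim, of "nat (m - k)" "nat (m - k')"]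
        mem[of k w] mem[of k' w']
      by (auto simp: x y retract_node simp del: set_append split: if_splits)
  qed
qed

lemma tm_val_retract:
  assumes "wf_tm tree_lang t" "range v \<subseteq> univ (tree UNIV)"
  shows "tm_val (tree K') (retract m N \<circ> v) t = retract m N (tm_val (tree UNIV) v t)"
  using assms(1)
proof (induction t)
  case (App f ts)
  have "length ts = 1" using App.prems by (simp add: tree_lang_def)
  then obtain t where ts: "ts = [t]" by (cases ts) auto
  then have t: "wf_tm tree_lang t" using App.prems by simp
  have "tm_val (tree K') (retract m N \<circ> v) t = retract m N (tm_val (tree UNIV) v t)"
    using App.IH ts t by (simp del: o_apply)
  moreover have "tm_val (tree UNIV) v t \<in> univ (tree UNIV)"
    by (rule tm_val_in_univ[OF is_struct_tree_UNIV assms(2) t])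
  ultimately show ?case
    using retract_fn_int[of _ m N UNIV f K'] by (simp add: ts del: o_apply)
qed simp

text \<open>For a single equation every large \<open>N\<close> keeps different term values apart. A
  finitary formula combines finitely many such conditions, so they hold together for large
  \<open>N\<close>; infinitely many equations might admit no common \<open>N\<close>.\<close>

lemma eventually_sat_retract:
  assumes "fin_qf \<phi>" "wf_fm tree_lang \<phi>" "range v \<subseteq> univ (tree UNIV)"
  shows "\<forall>\<^sub>F N in sequentially. sat (tree K') \<phi> (retract m N \<circ> v) \<longleftrightarrow> sat (tree UNIV) \<phi> v"
  using assms(1,2)
proof (induction rule: fin_qf.induct)
  case (1 s t)
  then have "\<forall>\<^sub>F N in sequentially.
      retract m N (tm_val (tree UNIV) v s) = retract m N (tm_val (tree UNIV) v t) \<longleftrightarrow>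
      tm_val (tree UNIV) v s = tm_val (tree UNIV) v t"
    using tm_val_in_univ[OF is_struct_tree_UNIV assms(3)] by (intro eventually_retract_inject) auto
  then show ?case using 1 assms(3) by (simp add: tm_val_retract del: o_apply)
next
  case (2 r ts)
  then show ?case by (simp add: tree_lang_def)
next
  case (3 \<phi>)
  then show ?case by simp
next
  case (4 \<Phi>)
  then have "\<forall>\<^sub>F N in sequentially. \<forall>\<phi>\<in>rcset \<Phi>.
      sat (tree K') \<phi> (retract m N \<circ> v) \<longleftrightarrow> sat (tree UNIV) \<phi> v"
    by (intro eventually_ball_finite) (auto simp: wf_fm_CConj simp del: wf_fm.simps o_apply)
  then show ?case
    by eventually_elim (auto simp: sat_CConj simp del: sat.simps o_apply)
next
  case (5 \<Phi>)
  then have "\<forall>\<^sub>F N in sequentially. \<forall>\<phi>\<in>rcset \<Phi>.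
      sat (tree K') \<phi> (retract m N \<circ> v) \<longleftrightarrow> sat (tree UNIV) \<phi> v"
    by (intro eventually_ball_finite) (auto simp: wf_fm_CDisj simp del: wf_fm.simps o_apply)
  then show ?case
    by eventually_elim (auto simp: sat_CDisj simp del: sat.simps o_apply)
qed

lemma sat_retract:
  assumes "fin_qf \<phi>" "wf_fm tree_lang \<phi>" "range v \<subseteq> univ (tree UNIV)"
  obtains N where "sat (tree {m..}) \<phi> (retract m N \<circ> v) \<longleftrightarrow> sat (tree UNIV) \<phi> v"
  using eventually_sat_retract[OF assms, of "{m..}" m] unfolding eventually_sequentially by blast

lemma range_retract:
  assumes "range v \<subseteq> univ (tree UNIV)"
  shows "range (retract m N \<circ> v) \<subseteq> univ (tree {m..})"
  using assms retract_in_tree by fastforce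

section \<open>Upward preservation of Sigma-1 and Pi-1 formulas\<close>

lemma tree_atLeast_subset: "univ (tree {m..}) \<subseteq> univ (tree UNIV)"
  by (auto simp: univ_tree)

text \<open>All trees share their functions and relations, and no quantifier is there to notice the
  universe.\<close>

lemma sat_fin_qf_tree: "fin_qf \<phi> \<Longrightarrow> sat (tree K) \<phi> v \<longleftrightarrow> sat (tree K') \<phi> v"
proof (induction rule: fin_qf.induct)
  case (1 s t)
  have "tm_val (tree K) v t = tm_val (tree K') v t" for t
    by (induction t) (simp_all add: tree_def cong: map_cong)
  then show ?case by simp
next
  case (2 r ts)
  then show ?case by (simp add: tree_def)
qed (auto simp: sat_CConj sat_CDisj simp del: sat.simps(4,5))

text \<open>Witnesses in the smaller tree are still present in the larger one. Levels 0 and 1 are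
  treated together because a matrix inside a level 2 formula may have either level.\<close>

lemma Sigma1_tree_up:
  assumes "Sigma0 n \<phi>" "n < 2" and v: "range v \<subseteq> univ (tree {m..})"
    and sat: "sat (tree {m..}) \<phi> v"
  shows "sat (tree UNIV) \<phi> v"
proof (cases "n = 0")
  case True
  then show ?thesis using assms sat_fin_qf_tree by (metis Sigma0_0_iff)
next
  case False
  then obtain \<Phi> where \<Phi>: "\<phi> = CDisj \<Phi>"
    "\<And>\<psi>. \<psi> \<in> rcset \<Phi> \<Longrightarrow> \<exists>xs \<chi> m. m < n \<and> Pi0 m \<chi> \<and> \<psi> = foldr Exi xs \<chi>"
    using assms(1) Sigma0_pos_E by blast
  have vU: "range v \<subseteq> univ (tree UNIV)" using v tree_atLeast_subset by blast
  obtain \<psi> where \<psi>: "\<psi> \<in> rcset \<Phi>" "sat (tree {m..}) \<psi> v"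
    using sat by (auto simp: \<Phi> sat_CDisj simp del: sat.simps)
  obtain xs \<chi> where \<chi>: "Pi0 0 \<chi>" "\<psi> = foldr Exi xs \<chi>"
    using \<Phi>(2)[OF \<psi>(1)] assms(2) by (auto simp: less_2_cases_iff)
  obtain u where u: "range u \<subseteq> univ (tree {m..})" "\<forall>i. i \<notin> set xs \<longrightarrow> u i = v i"
      "sat (tree {m..}) \<chi> u"
    using \<psi>(2) sat_foldr_Exi[OF v] \<chi>(2) by blast
  have "sat (tree UNIV) \<psi> v"
    unfolding \<chi>(2) sat_foldr_Exi[OF vU]
    using u tree_atLeast_subset sat_fin_qf_tree \<chi>(1) Pi0_0_iff by (metis subset_trans)
  then show ?thesis using \<psi>(1) by (auto simp: \<Phi> sat_CDisj simp del: sat.simps)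
qed

text \<open>A counterexample \<open>u\<close> in the larger tree is pulled back by
  \<open>retract\<close>, which fixes the parameters \<open>v\<close> because they lie in
  \<open>tree {m..}\<close>, and which preserves the matrix for a suitable \<open>N\<close>.\<close>

lemma Pi1_tree_up:
  assumes "Pi0 n \<phi>" "n < 2" "wf_fm tree_lang \<phi>" and v: "range v \<subseteq> univ (tree {m..})"
    and sat: "sat (tree {m..}) \<phi> v"
  shows "sat (tree UNIV) \<phi> v"
proof (cases "n = 0")
  case True
  then show ?thesis using assms sat_fin_qf_tree by (metis Pi0_0_iff)
next
  case False
  then obtain \<Phi> where \<Phi>: "\<phi> = CConj \<Phi>"
    "\<And>\<psi>. \<psi> \<in> rcset \<Phi> \<Longrightarrow> \<exists>xs \<chi> m. m < n \<and> Sigma0 m \<chi> \<and> \<psi> = foldr Uni xs \<chi>"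
    using assms(1) Pi0_pos_E by blast
  have vU: "range v \<subseteq> univ (tree UNIV)" using v tree_atLeast_subset by blast
  have "sat (tree UNIV) \<psi> v" if \<psi>: "\<psi> \<in> rcset \<Phi>" for \<psi>
  proof -
    obtain xs \<chi> where \<chi>: "Sigma0 0 \<chi>" "\<psi> = foldr Uni xs \<chi>"
      using \<Phi>(2)[OF \<psi>] assms(2) by (auto simp: less_2_cases_iff)
    have wf: "wf_fm tree_lang \<chi>"
      using assms(3) \<psi> \<chi>(2) by (auto simp: \<Phi> wf_fm_CConj simp del: wf_fm.simps)
    have \<psi>v: "sat (tree {m..}) \<psi> v"
      using sat \<psi> by (auto simp: \<Phi> sat_CConj simp del: sat.simps)
    have "sat (tree UNIV) \<chi> u"
      if u: "range u \<subseteq> univ (tree UNIV)" "\<forall>i. i \<notin> set xs \<longrightarrow> u i = v i" for u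
    proof -
      obtain N where N: "sat (tree {m..}) \<chi> (retract m N \<circ> u) \<longleftrightarrow> sat (tree UNIV) \<chi> u"
        using sat_retract[OF _ wf u(1)] \<chi>(1) by (metis Sigma0_0_iff)
      have "\<forall>i. i \<notin> set xs \<longrightarrow> (retract m N \<circ> u) i = v i"
        using u(2) v retract_id by (auto simp: image_subset_iff)
      then show ?thesis
        using \<psi>v range_retract[OF u(1)] N unfolding \<chi>(2) sat_foldr_Uni[OF v] by blast
    qed
    then show ?thesis unfolding \<chi>(2) sat_foldr_Uni[OF vU] by blast
  qed
  then show ?thesis by (auto simp: \<Phi> sat_CConj simp del: sat.simps)
qed

section \<open>Transfer of d-Sigma-2 sentences to the tree with trunk indexed by all
  integers\<close>

lemma models_tree_shift:
  assumes "wf_fm tree_lang \<phi>" "models (tree {0..}) \<phi>"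
  shows "models (tree {m..}) \<phi>"
  unfolding models_def
proof (intro allI impI)
  fix v :: "nat \<Rightarrow> nat" assume v: "range v \<subseteq> univ (tree {m..})"
  define h where "h x = (case from_nat x of (k, w) \<Rightarrow> node (k - m) w)" for x
  have h [simp]: "h (node k w) = node (k - m) w" for k w by (simp add: h_def)
  have bij: "bij_betw h (univ (tree {m..})) (univ (tree {0..}))"
  proof (rule bij_betw_imageI)
    show "inj_on h (univ (tree {m..}))" by (auto simp: inj_on_def univ_tree)
    have "node k w \<in> h ` univ (tree {m..})" if "0 \<le> k" for k w
      using that by (intro image_eqI[of _ _ "node (k + m) w"]) auto
    then show "h ` univ (tree {m..}) = univ (tree {0..})" by (auto simp: univ_tree)
  qed
  have fn: "h (fn_int (tree {m..}) f xs) = fn_int (tree {0..}) f (map h xs)"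
    if xs: "fn_arity tree_lang f = Some (length xs)" "set xs \<subseteq> univ (tree {m..})" for f xs
  proof -
    obtain k w where x: "xs = [node k w]"
      using xs by (cases xs) (auto simp: tree_lang_def univ_tree)
    show ?thesis by (cases f; cases w) (simp_all add: x tree_def)
  qed
  have "sat (tree {m..}) \<phi> v \<longleftrightarrow> sat (tree {0..}) \<phi> (h \<circ> v)"
    by (rule sat_isomorphism[OF is_struct_tree_atLeast bij fn])
      (use assms v in \<open>auto simp: tree_lang_def\<close>)
  moreover have "range (h \<circ> v) \<subseteq> univ (tree {0..})"
    using v bij_betw_imp_surj_on[OF bij] by fastforce
  ultimately show "sat (tree {m..}) \<phi> v" using assms(2) by (simp add: models_def)
qed

text \<open>\<open>tree UNIV\<close> is the union of the chain of the trees
  \<open>tree {m..}\<close>. The bound on \<open>m\<close> keeps \<open>tree {0..}\<close>, where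
  the parameters lie, inside the chosen one.\<close>

lemma finite_subset_tree_atLeast:
  assumes "finite X" "X \<subseteq> univ (tree UNIV)"
  shows "\<exists>m\<le>0. X \<subseteq> univ (tree {m..})"
  using assms
proof (induction X)
  case (insert x X)
  then obtain m where m: "m \<le> 0" "X \<subseteq> univ (tree {m..})" by auto
  obtain k w where x: "x = node k w" using insert.prems by (auto simp: univ_tree)
  have "univ (tree {m..}) \<subseteq> univ (tree {min m k..})" by (auto simp: univ_tree)
  then show ?case using m x by (intro exI[of _ "min m k"]) auto
qed auto

lemma tm_val_cong_vars:
  "(\<And>x. x \<in> tm_vars t \<Longrightarrow> u x = v x) \<Longrightarrow> tm_val A u t = tm_val A v t"
proof (induction t)
  case (App f ts)
  then have "map (tm_val A u) ts = map (tm_val A v) ts" by auto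
  then show ?case by (simp only: tm_val.simps)
qed simp

text \<open>Lets the transfer be carried out for one valuation in \<open>tree {0..}\<close> and then
  be extended to all valuations in \<open>tree UNIV\<close>.\<close>

lemma sat_cong_free_vars:
  "(\<And>x. x \<in> free_vars \<phi> \<Longrightarrow> u x = v x) \<Longrightarrow> sat A \<phi> u \<longleftrightarrow> sat A \<phi> v"
proof (induction \<phi> arbitrary: u v)
  case (Eq s t)
  then show ?case using tm_val_cong_vars[of s u v A] tm_val_cong_vars[of t u v A] by simp
next
  case (Rel r ts)
  then have "map (tm_val A u) ts = map (tm_val A v) ts"
    by (auto intro!: tm_val_cong_vars)
  then show ?case by (simp only: sat.simps)
next
  case (CConj \<Phi>)
  have "sat A \<phi> u \<longleftrightarrow> sat A \<phi> v" if "\<phi> \<in> rcset \<Phi>" for \<phi>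
  proof (rule CConj.IH[OF that])
    show "u x = v x" if "x \<in> free_vars \<phi>" for x
      using CConj.prems[of x] that \<open>\<phi> \<in> rcset \<Phi>\<close> unfolding free_vars_CConj by blast
  qed
  then show ?case unfolding sat_CConj by blast
next
  case (CDisj \<Phi>)
  have "sat A \<phi> u \<longleftrightarrow> sat A \<phi> v" if "\<phi> \<in> rcset \<Phi>" for \<phi>
  proof (rule CDisj.IH[OF that])
    show "u x = v x" if "x \<in> free_vars \<phi>" for x
      using CDisj.prems[of x] that \<open>\<phi> \<in> rcset \<Phi>\<close> unfolding free_vars_CDisj by blast
  qed
  then show ?case unfolding sat_CDisj by blast
next
  case (Neg \<phi>)
  have "sat A \<phi> u \<longleftrightarrow> sat A \<phi> v"
    by (rule Neg.IH) (use Neg.prems in simp)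
  then show ?case by simp
next
  case (Exi x \<phi>)
  have "sat A \<phi> (u(x := a)) \<longleftrightarrow> sat A \<phi> (v(x := a))" for a
    by (rule Exi.IH) (use Exi.prems in auto)
  then show ?case by simp
next
  case (Uni x \<phi>)
  have "sat A \<phi> (u(x := a)) \<longleftrightarrow> sat A \<phi> (v(x := a))" for a
    by (rule Uni.IH) (use Uni.prems in auto)
  then show ?case by simp
qed

text \<open>The existential witnesses are kept, and the matrix goes up by
  \<open>Pi1_tree_up\<close>.\<close>

lemma Sigma2_tree_UNIV:
  assumes "Sigma0 2 \<phi>" "wf_fm tree_lang \<phi>" and v: "range v \<subseteq> univ (tree {m..})"
    and sat: "sat (tree {m..}) \<phi> v"
  shows "sat (tree UNIV) \<phi> v"
proof -
  obtain \<Phi> where \<Phi>: "\<phi> = CDisj \<Phi>"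
    "\<And>\<psi>. \<psi> \<in> rcset \<Phi> \<Longrightarrow> \<exists>xs \<chi> m. m < 2 \<and> Pi0 m \<chi> \<and> \<psi> = foldr Exi xs \<chi>"
    using assms(1) Sigma0_pos_E[of 2] by (metis zero_less_numeral)
  have vU: "range v \<subseteq> univ (tree UNIV)" using v tree_atLeast_subset by blast
  obtain \<psi> where \<psi>: "\<psi> \<in> rcset \<Phi>" "sat (tree {m..}) \<psi> v"
    using sat by (auto simp: \<Phi> sat_CDisj simp del: sat.simps)
  obtain xs \<chi> n where \<chi>: "n < 2" "Pi0 n \<chi>" "\<psi> = foldr Exi xs \<chi>"
    using \<Phi>(2)[OF \<psi>(1)] by blast
  have wf: "wf_fm tree_lang \<chi>"
    using assms(2) \<psi>(1) \<chi>(3) by (auto simp: \<Phi> wf_fm_CDisj simp del: wf_fm.simps)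
  obtain u where u: "range u \<subseteq> univ (tree {m..})" "\<forall>i. i \<notin> set xs \<longrightarrow> u i = v i"
      "sat (tree {m..}) \<chi> u"
    using \<psi>(2) sat_foldr_Exi[OF v] \<chi>(3) by blast
  have "range u \<subseteq> univ (tree UNIV)" using u(1) tree_atLeast_subset by blast
  moreover have "sat (tree UNIV) \<chi> u" using Pi1_tree_up \<chi>(1,2) wf u(1,3) by blast
  ultimately have "sat (tree UNIV) \<psi> v"
    unfolding \<chi>(3) sat_foldr_Exi[OF vU] using u(2) by blast
  then show ?thesis using \<psi>(1) by (auto simp: \<Phi> sat_CDisj simp del: sat.simps)
qed

text \<open>The values of a universal block are finitely many, hence lie in some
  \<open>tree {m..}\<close>. In this copy of \<open>tree {0..}\<close> the matrix holds, and it goes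
  up by \<open>Sigma1_tree_up\<close>. Truth is assumed under all valuations because the isomorphism
  between the copies moves \<open>v\<close>.\<close>

lemma Pi2_tree_UNIV:
  assumes "Pi0 2 \<phi>" "wf_fm tree_lang \<phi>" and v: "range v \<subseteq> univ (tree {0..})"
    and mod: "models (tree {0..}) \<phi>"
  shows "sat (tree UNIV) \<phi> v"
proof -
  obtain \<Phi> where \<Phi>: "\<phi> = CConj \<Phi>"
    "\<And>\<psi>. \<psi> \<in> rcset \<Phi> \<Longrightarrow> \<exists>xs \<chi> m. m < 2 \<and> Sigma0 m \<chi> \<and> \<psi> = foldr Uni xs \<chi>"
    using assms(1) Pi0_pos_E[of 2] by (metis zero_less_numeral)
  have vU: "range v \<subseteq> univ (tree UNIV)" using v tree_atLeast_subset by blast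
  have "sat (tree UNIV) \<psi> v" if \<psi>: "\<psi> \<in> rcset \<Phi>" for \<psi>
  proof -
    obtain xs \<chi> n where \<chi>: "n < 2" "Sigma0 n \<chi>" "\<psi> = foldr Uni xs \<chi>"
      using \<Phi>(2)[OF \<psi>] by blast
    have "sat (tree UNIV) \<chi> u"
      if u: "range u \<subseteq> univ (tree UNIV)" "\<forall>i. i \<notin> set xs \<longrightarrow> u i = v i" for u
    proof -
      obtain m where m: "m \<le> 0" "u ` set xs \<subseteq> univ (tree {m..})"
        using finite_subset_tree_atLeast[of "u ` set xs"] u(1) by auto
      have "univ (tree {0..}) \<subseteq> univ (tree {m..})" using m(1) by (auto simp: univ_tree)
      then have vm: "range v \<subseteq> univ (tree {m..})" using v by blast
      \<comment> \<open>Outside the block \<open>u\<close> agrees with \<open>v\<close>, so only the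
        values on \<open>set xs\<close> had to be captured.\<close>
      have um: "range u \<subseteq> univ (tree {m..})"
      proof
        fix y assume "y \<in> range u"
        then obtain i where "y = u i" by blast
        then show "y \<in> univ (tree {m..})" using u(2) m(2) vm by (cases "i \<in> set xs") auto
      qed
      have "sat (tree {m..}) \<psi> v"
        using models_tree_shift[OF assms(2) mod, of m] vm \<psi>
        by (auto simp: models_def \<Phi> sat_CConj simp del: sat.simps)
      then have "sat (tree {m..}) \<chi> u" using um u(2) unfolding \<chi>(3) sat_foldr_Uni[OF vm] by blast
      then show ?thesis using Sigma1_tree_up \<chi>(1,2) um by blast
    qed
    then show ?thesis unfolding \<chi>(3) sat_foldr_Uni[OF vU] by blast
  qed
  then show ?thesis by (auto simp: \<Phi> sat_CConj simp del: sat.simps)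
qed

lemma dSigma2_tree_UNIV:
  assumes "dSigma0 2 \<theta>" "sentence tree_lang \<theta>" "models (tree {0..}) \<theta>"
  shows "models (tree UNIV) \<theta>"
proof -
  obtain \<phi> \<psi> where \<theta>: "Sigma0 2 \<phi>" "Pi0 2 \<psi>" "\<theta> = CConj (cinsert \<phi> (cinsert \<psi> cempty))"
    using assms(1) unfolding dSigma0_def by blast
  have rc: "rcset (cinsert \<phi> (cinsert \<psi> cempty)) = {\<phi>, \<psi>}"
    by (simp add: cinsert.rep_eq bot_cset.rep_eq)
  have wf: "wf_fm tree_lang \<phi>" "wf_fm tree_lang \<psi>"
    using assms(2) by (simp_all add: sentence_def \<theta>(3) wf_fm_CConj rc del: wf_fm.simps)
  have sat_\<theta>: "sat A \<theta> v \<longleftrightarrow> sat A \<phi> v \<and> sat A \<psi> v" for A :: "nat struct" and v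
    by (simp add: \<theta>(3) sat_CConj rc del: sat.simps)
  define v :: "nat \<Rightarrow> nat" where "v = (\<lambda>_. node 0 [])"
  have v: "range v \<subseteq> univ (tree {0..})" by (simp add: v_def)
  have "models (tree {0..}) \<phi>" "models (tree {0..}) \<psi>"
    using assms(3) by (simp_all add: models_def sat_\<theta>)
  then have "sat (tree UNIV) \<theta> v"
    using Sigma2_tree_UNIV[OF \<theta>(1) wf(1) v] Pi2_tree_UNIV[OF \<theta>(2) wf(2) v] v
    by (simp add: sat_\<theta> models_def)
  moreover have "sat (tree UNIV) \<theta> u \<longleftrightarrow> sat (tree UNIV) \<theta> v" for u
    by (rule sat_cong_free_vars) (use assms(2) in \<open>simp add: sentence_def\<close>)
  ultimately show ?thesis unfolding models_def by blast
qed


section \<open>The quasi Scott sentence\<close>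

definition on_trunk :: "'a struct \<Rightarrow> 'a \<Rightarrow> bool" where
  "on_trunk B x \<longleftrightarrow> (\<forall>n. child B n (parent B x) \<noteq> x)"

definition has_trunk :: "'a struct \<Rightarrow> bool" where
  "has_trunk B \<longleftrightarrow> (\<exists>x\<in>univ B. on_trunk B x)"

text \<open>The Pi-2 half of the sentence, \<open>has_trunk\<close> being the Sigma-2 half. The
  first two clauses serve to put any finite set into the substructure generated by one trunk node;
  the others serve mainly to make coordinates of nodes unique. \<open>tree UNIV\<close> satisfies
  all of them, so finite generation is essential for uniqueness.\<close>

definition tree_axioms :: "'a struct \<Rightarrow> bool" where
  "tree_axioms B \<longleftrightarrow>
     (\<forall>x\<in>univ B. \<forall>y\<in>univ B. on_trunk B x \<longrightarrow> on_trunk B y \<longrightarrow>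
        (\<exists>k. x = (parent B ^^ k) y \<or> y = (parent B ^^ k) x)) \<and>
     (\<forall>x\<in>univ B. \<forall>y\<in>univ B. \<exists>j k. (parent B ^^ j) x = (parent B ^^ k) y) \<and>
     (\<forall>n. \<forall>x\<in>univ B. parent B (child B n x) = x) \<and>
     (\<forall>n m. n \<noteq> m \<longrightarrow> (\<forall>x\<in>univ B. child B n x \<noteq> child B m x)) \<and>
     (\<forall>j. \<forall>x\<in>univ B. (parent B ^^ Suc j) x \<noteq> x) \<and>
     (\<forall>x\<in>univ B. on_trunk B x \<longrightarrow> on_trunk B (parent B x))"

section \<open>The trees satisfy the axioms\<close>

lemma on_trunk_tree:
  "on_trunk (tree K) (node k w) \<longleftrightarrow> w = []"
  by (cases w) (auto simp: on_trunk_def)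

lemma tree_parent_pow_Nil: "(tree_parent ^^ j) (node k []) = node (k + int j) []"
  by (induction j) (auto simp: algebra_simps)

lemma tree_parent_pow_length: "(tree_parent ^^ length w) (node k w) = node k []"
proof (induction w)
  case (Cons n w)
  then show ?case by (simp add: funpow_swap1)
qed simp

lemma tree_axioms_tree: "tree_axioms (tree K)"
  unfolding tree_axioms_def
proof (intro conjI allI impI ballI)
  fix x y assume "x \<in> univ (tree K)" "y \<in> univ (tree K)" "on_trunk (tree K) x" "on_trunk (tree K) y"
  then obtain k k' where xy: "x = node k []" "y = node k' []" by (auto simp: univ_tree on_trunk_tree)
  show "\<exists>i. x = (parent (tree K) ^^ i) y \<or> y = (parent (tree K) ^^ i) x"
    by (rule exI[of _ "nat \<bar>k - k'\<bar>"]) (auto simp: xy tree_parent_pow_Nil)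
next
  fix x y assume "x \<in> univ (tree K)" "y \<in> univ (tree K)"
  then obtain k w k' w' where xy: "x = node k w" "y = node k' w'" by (auto simp: univ_tree)
  \<comment> \<open>Each node reaches the trunk by using up its word and then climbs to the higher
    of the two trunk positions.\<close>
  define M where "M = max k k'"
  have "(tree_parent ^^ (nat (M - k) + length w)) x = node M []"
    "(tree_parent ^^ (nat (M - k') + length w')) y = node M []"
    by (simp_all add: xy funpow_add tree_parent_pow_length tree_parent_pow_Nil M_def)
  then show "\<exists>i j. (parent (tree K) ^^ i) x = (parent (tree K) ^^ j) y" by (metis parent_tree)
next
  fix x n assume "x \<in> univ (tree K)"
  then show "parent (tree K) (child (tree K) n x) = x" by (auto simp: univ_tree)
next
  fix x n m assume "x \<in> univ (tree K)" "(n :: nat) \<noteq> m"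
  then show "child (tree K) n x \<noteq> child (tree K) m x" by (auto simp: univ_tree)
next
  fix x j assume "x \<in> univ (tree K)"
  then obtain k w where x: "x = node k w" by (auto simp: univ_tree)
  \<comment> \<open>The height \<open>k - length w\<close> grows by one under every parent step,
    which rules out cycles.\<close>
  define h where "h y = (case from_nat y of (k, w :: nat list) \<Rightarrow> k - int (length w))" for y
  have h [simp]: "h (node k w) = k - int (length w)" for k w by (simp add: h_def)
  have "\<exists>l u. (tree_parent ^^ i) x = node l u \<and> h (node l u) = h x + int i" for i
  proof (induction i)
    case (Suc i)
    then obtain l u where lu: "(tree_parent ^^ i) x = node l u" "h (node l u) = h x + int i" by blast
    then show ?case by (cases u) auto
  qed (simp add: x)
  then have "h ((tree_parent ^^ Suc j) x) = h x + int (Suc j)" by metis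
  then show "(parent (tree K) ^^ Suc j) x \<noteq> x" by (metis add_cancel_right_right
    of_nat_eq_0_iff nat.distinct(1) parent_tree)
next
  fix x assume "x \<in> univ (tree K)" "on_trunk (tree K) x"
  then show "on_trunk (tree K) (parent (tree K) x)" by (auto simp: univ_tree on_trunk_tree)
qed

lemma has_trunk_tree: "has_trunk (tree {0..})"
  unfolding has_trunk_def by (intro bexI[of _ "node 0 []"]) (simp_all add: on_trunk_tree)

text \<open>Finite generation yields a single trunk node \<open>b\<close> that generates
  \<open>B\<close>. Every element is reached from \<open>b\<close> by climbing the trunk and then
  descending along a word, in exactly one way, and these coordinates give the isomorphism.\<close>

lemma isomorphic_treeI:
  assumes B: "is_struct tree_lang B" "tree_axioms B" "has_trunk B" "finitely_generated tree_lang B"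
  shows "isomorphic tree_lang (tree {0..}) B"
proof -
  let ?s = "parent B" and ?g = "child B"
  have s [simp]: "?s x \<in> univ B" and g [simp]: "?g n x \<in> univ B" if "x \<in> univ B" for x n
    using B(1) that by (auto simp: is_struct_tree_lang)
  have sk [simp]: "(?s ^^ k) x \<in> univ B" if "x \<in> univ B" for x k
    using that by (induction k) auto
  have sg [simp]: "?s (?g n x) = x" if "x \<in> univ B" for x n
    using B(2) that unfolding tree_axioms_def by blast
  have g_inj: "n = m" if "x \<in> univ B" "?g n x = ?g m x" for x n m
    using B(2) that unfolding tree_axioms_def by blast
  have acyclic: "(?s ^^ Suc j) x \<noteq> x" if "x \<in> univ B" for x j
    using B(2) that unfolding tree_axioms_def by blast
  have trunk_s: "on_trunk B (?s x)" if "x \<in> univ B" "on_trunk B x" for x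
    using B(2) that unfolding tree_axioms_def by blast
  have total: "\<exists>k. x = (?s ^^ k) y \<or> y = (?s ^^ k) x"
    if "x \<in> univ B" "y \<in> univ B" "on_trunk B x" "on_trunk B y" for x y
    using B(2) that unfolding tree_axioms_def by blast
  have meet: "\<exists>j k. (?s ^^ j) x = (?s ^^ k) y" if "x \<in> univ B" "y \<in> univ B" for x y
    using B(2) that unfolding tree_axioms_def by blast
  have trunk_sk: "on_trunk B ((?s ^^ k) x)" if "x \<in> univ B" "on_trunk B x" for x k
    using that by (induction k) (auto intro: trunk_s)

  \<comment> \<open>The intended image of \<open>node k w\<close> when \<open>node 0 []\<close> goes
    to \<open>b\<close>. For \<open>b\<close> in the universe, \<open>C b\<close> is the
    substructure generated by \<open>b\<close>.\<close>
  define el where "el b k w = foldr ?g w ((?s ^^ k) b)" for b k w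
  define C where "C b = {el b k w | k w. True}" for b
  have el_univ: "el b k w \<in> univ B" if "b \<in> univ B" for b k w
    using that by (induction w) (auto simp: el_def)
  have C_g: "?g n x \<in> C b" if "x \<in> C b" for x b n
  proof -
    obtain k w where "x = el b k w" using \<open>x \<in> C b\<close> by (auto simp: C_def)
    then have "?g n x = el b k (n # w)" by (simp add: el_def)
    then show ?thesis by (auto simp: C_def)
  qed
  have el_Nil: "?s (el b k []) = el b (Suc k) []" for b k by (simp add: el_def)
  have el_Cons: "?s (el b k (n # w)) = el b k w" if "b \<in> univ B" for b k n w
    using el_univ[OF that, of k w] by (simp add: el_def)
  have C_s: "?s x \<in> C b" if "x \<in> C b" "b \<in> univ B" for x b
  proof -
    obtain k w where x: "x = el b k w" using \<open>x \<in> C b\<close> by (auto simp: C_def)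
    have "?s x = (case w of [] \<Rightarrow> el b (Suc k) [] | n # w' \<Rightarrow> el b k w')"
      using el_Nil el_Cons[OF that(2)] by (auto simp: x split: list.split)
    then show ?thesis by (auto simp: C_def split: list.splits)
  qed
  \<comment> \<open>Climbing from \<open>b\<close> can only shrink the generated part, so comparable
    trunk nodes give nested sets.\<close>
  have C_sub: "C ((?s ^^ k) b) \<subseteq> C b" for k b
  proof -
    have "el ((?s ^^ k) b) j w = el b (j + k) w" for j w by (simp add: el_def funpow_add)
    then show ?thesis unfolding C_def by blast
  qed
  have C_self: "b \<in> C b" for b
  proof -
    have "b = el b 0 []" by (simp add: el_def)
    then show ?thesis unfolding C_def by blast
  qed

  obtain a where a: "a \<in> univ B" "on_trunk B a" using B(3) unfolding has_trunk_def by blast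
  \<comment> \<open>Climb from \<open>y\<close> until the trunk is met. A node off the trunk is a
    child of its parent, so membership in \<open>C b\<close> passes back down from the
    parent.\<close>
  have cover1: "\<exists>b\<in>univ B. on_trunk B b \<and> y \<in> C b"
    if "y \<in> univ B" "on_trunk B ((?s ^^ j) y)" for y j
    using that
  proof (induction j arbitrary: y)
    case 0
    then show ?case using C_self by auto
  next
    case (Suc j)
    show ?case
    proof (cases "on_trunk B y")
      case True
      then show ?thesis using Suc.prems(1) C_self by blast
    next
      case False
      then obtain n where n: "?g n (?s y) = y" by (auto simp: on_trunk_def)
      have "\<exists>b\<in>univ B. on_trunk B b \<and> ?s y \<in> C b"
        using Suc.IH[of "?s y"] Suc.prems by (simp add: funpow_swap1)
      then show ?thesis using C_g n by metis
    qed
  qed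
  have cover: "\<exists>b\<in>univ B. on_trunk B b \<and> y \<in> C b" if y: "y \<in> univ B" for y
  proof -
    \<comment> \<open>The ancestor shared with the trunk node \<open>a\<close> is itself on the
      trunk, since the trunk is closed under parents.\<close>
    obtain j k where "(?s ^^ j) y = (?s ^^ k) a" using meet[OF y a(1)] by blast
    then show ?thesis using cover1[OF y, of j] trunk_sk[OF a, of k] by simp
  qed
  have cover_finite: "\<exists>b\<in>univ B. on_trunk B b \<and> X \<subseteq> C b" if "finite X" "X \<subseteq> univ B" for X
    using that
  proof (induction X)
    case empty
    then show ?case using a by auto
  next
    case (insert x X)
    then obtain b where b: "b \<in> univ B" "on_trunk B b" "X \<subseteq> C b" by auto
    obtain b' where b': "b' \<in> univ B" "on_trunk B b'" "x \<in> C b'" using cover insert.prems by blast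
    \<comment> \<open>Comparability of trunk nodes makes one of the two sets contain the other; the
      larger one covers everything.\<close>
    obtain k where "b = (?s ^^ k) b' \<or> b' = (?s ^^ k) b" using total b(1,2) b'(1,2) by blast
    then have "C b \<subseteq> C b' \<or> C b' \<subseteq> C b" using C_sub by metis
    then show ?case using b b' by blast
  qed
  obtain G where G: "finite G" "G \<subseteq> univ B" "generated tree_lang B G = univ B"
    using B(4) unfolding finitely_generated_def by blast
  obtain b where b: "b \<in> univ B" "on_trunk B b" "G \<subseteq> C b" using cover_finite G(1,2) by blast
  have "x \<in> C b" if "x \<in> generated tree_lang B G" for x
    using that
  proof induction
    case (base x)
    then show ?case using b(3) by blast
  next
    case (app f n xs)
    then obtain x where x: "xs = [x]" "x \<in> C b" by (auto simp: tree_lang_def length_Suc_conv)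
    show ?case
      using C_s[OF x(2) b(1)] C_g[OF x(2)] by (cases f) (auto simp: x(1) parent_def child_def)
  qed
  then have UC: "univ B = C b" using G(3) el_univ[OF b(1)] by (auto simp: C_def)

  define h where "h x = (case from_nat x of (k, w) \<Rightarrow> el b (nat k) w)" for x
  have h [simp]: "h (node k w) = el b (nat k) w" for k w by (simp add: h_def)
  \<comment> \<open>The left side is on the trunk, whereas the right side is the \<open>n\<close>-th
    child of its own parent.\<close>
  have off: "el b k [] \<noteq> el b k' (n # w)" for k k' n w
  proof
    assume eq: "el b k [] = el b k' (n # w)"
    then have "?s (el b k []) = el b k' w" using el_Cons[OF b(1)] by simp
    then have "?g n (?s (el b k [])) = el b k []" using eq by (simp add: el_def)
    moreover have "on_trunk B (el b k [])" using trunk_sk[OF b(1,2)] by (simp add: el_def)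
    ultimately show False by (simp add: on_trunk_def)
  qed
  \<comment> \<open>Two climbs of different length to the same node would close a cycle.\<close>
  have chain_inj: "k = k'" if "(?s ^^ k) b = (?s ^^ k') b" for k k'
  proof (rule ccontr)
    have *: False if "i < j" "(?s ^^ i) b = (?s ^^ j) b" for i j
    proof -
      obtain d where d: "j = Suc d + i" using \<open>i < j\<close> by (metis less_natE add.commute add_Suc)
      have "(?s ^^ Suc d) ((?s ^^ i) b) = (?s ^^ i) b" using that(2) unfolding d funpow_add by simp
      then show False using acyclic[of "(?s ^^ i) b" d] b(1) by simp
    qed
    assume "k \<noteq> k'"
    then show False using * that by (metis linorder_neqE_nat)
  qed
  \<comment> \<open>Parent steps strip both words in parallel: \<open>off\<close> prevents one from
    ending first, \<open>g_inj\<close> recovers the letters, and \<open>chain_inj\<close> the trunk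
    position.\<close>
  have el_inj: "k = k' \<and> w = w'" if "el b k w = el b k' w'" for k k' w w'
    using that
  proof (induction w arbitrary: w')
    case Nil
    then have "w' = []" using off by (cases w') auto
    then show ?case using Nil chain_inj by (simp add: el_def)
  next
    case (Cons n w)
    then obtain n' u where w': "w' = n' # u" using off by (cases w') metis+
    have eq: "el b k w = el b k' u" using Cons.prems el_Cons[OF b(1)] unfolding w' by metis
    then have "?g n (el b k w) = ?g n' (el b k w)" using Cons.prems by (simp add: w' el_def)
    then show ?case using Cons.IH[OF eq] g_inj el_univ[OF b(1)] w' by blast
  qed
  have bij: "bij_betw h (univ (tree {0..})) (univ B)"
  proof (rule bij_betw_imageI)
    show "inj_on h (univ (tree {0..}))"
      by (auto simp: inj_on_def univ_tree dest!: el_inj)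
    have "el b k w \<in> h ` univ (tree {0..})" for k w
      by (intro image_eqI[of _ _ "node (int k) w"]) auto
    then show "h ` univ (tree {0..}) = univ B"
      unfolding UC by (fastforce simp: C_def univ_tree)
  qed
  have fn: "h (fn_int (tree {0..}) f xs) = fn_int B f (map h xs)"
    if xs: "length xs = 1" "set xs \<subseteq> univ (tree {0..})" for f xs
  proof -
    obtain k w where x: "xs = [node k w]" "k \<ge> 0"
      using xs by (cases xs) (auto simp: univ_tree)
    show ?thesis
    proof (cases f)
      case 0
      have "h (tree_parent (node k w)) = ?s (el b (nat k) w)"
        using x(2) el_Nil[of b "nat k"] el_Cons[OF b(1), of "nat k"]
        by (cases w) (auto simp: nat_add_distrib)
      then show ?thesis by (simp add: 0 x tree_def parent_def)
    next
      case (Suc n)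
      show ?thesis by (simp add: Suc x tree_def el_def child_def)
    qed
  qed
  show ?thesis
    unfolding isomorphic_def using bij fn by (intro exI[of _ h]) (auto simp: tree_lang_def)
qed

section \<open>The axioms as infinitary formulas and their complexity\<close>

definition parent_tm :: "tm \<Rightarrow> tm" where
  "parent_tm t = App 0 [t]"

definition child_tm :: "nat \<Rightarrow> tm \<Rightarrow> tm" where
  "child_tm n t = App (Suc n) [t]"

definition is_child :: "nat \<Rightarrow> tm \<Rightarrow> fm" where
  "is_child n t = Eq (child_tm n (parent_tm t)) t"

text \<open>The one-element disjunction is there because \<open>Sigma0\<close> at a positive level
  demands an outermost \<open>CDisj\<close>.\<close>

definition trunk_sentence :: fm where
  "trunk_sentence =
     CDisj (acset {Exi 0 (CConj (acset (range (\<lambda>n. Neg (is_child n (Var 0))))))})"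

text \<open>Implications from trunk membership become disjunctions with \<open>is_child\<close>
  formulas. Closure of the trunk under parents is contraposed and split into one sentence for each
  \<open>n\<close>, so that every matrix is quantifier-free or a countable disjunction of
  quantifier-free formulas.\<close>

definition axiom_set :: "fm set" where
  "axiom_set =
     range (\<lambda>n. Uni 0 (Eq (parent_tm (child_tm n (Var 0))) (Var 0))) \<union>
     (\<lambda>(n, m). Uni 0 (Neg (Eq (child_tm n (Var 0)) (child_tm m (Var 0))))) ` {(n, m). n \<noteq> m} \<union>
     range (\<lambda>j. Uni 0 (Neg (Eq ((parent_tm ^^ Suc j) (Var 0)) (Var 0)))) \<union>
     range (\<lambda>n. Uni 0 (CDisj (acset
       (insert (Neg (is_child n (parent_tm (Var 0)))) (range (\<lambda>m. is_child m (Var 0))))))) \<union>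
     {Uni 0 (Uni 1 (CDisj (acset
       (range (\<lambda>n. is_child n (Var 0)) \<union> range (\<lambda>n. is_child n (Var 1)) \<union>
        range (\<lambda>k. Eq (Var 0) ((parent_tm ^^ k) (Var 1))) \<union>
        range (\<lambda>k. Eq (Var 1) ((parent_tm ^^ k) (Var 0))))))),
      Uni 0 (Uni 1 (CDisj (acset
       (range (\<lambda>(j, k). Eq ((parent_tm ^^ j) (Var 0)) ((parent_tm ^^ k) (Var 1)))))))}"

definition axioms_sentence :: fm where
  "axioms_sentence = CConj (acset axiom_set)"

lemma countable_axiom_set: "countable axiom_set"
  unfolding axiom_set_def by (intro countable_Un countable_image countableI_type countable_insert) auto

lemma tm_val_parent_tm [simp]: "tm_val B v (parent_tm t) = parent B (tm_val B v t)"
  and tm_val_child_tm [simp]: "tm_val B v (child_tm n t) = child B n (tm_val B v t)"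
  by (simp_all add: parent_tm_def child_tm_def parent_def child_def)

lemma tm_val_parent_pow [simp]: "tm_val B v ((parent_tm ^^ k) t) = (parent B ^^ k) (tm_val B v t)"
  by (induction k) auto

lemma tm_vars_parent_tm [simp]: "tm_vars (parent_tm t) = tm_vars t"
  and tm_vars_child_tm [simp]: "tm_vars (child_tm n t) = tm_vars t"
  by (simp_all add: parent_tm_def child_tm_def)

lemma tm_vars_parent_pow [simp]: "tm_vars ((parent_tm ^^ k) t) = tm_vars t"
  by (induction k) auto

lemma wf_tm_parent_tm [simp]: "wf_tm tree_lang (parent_tm t) = wf_tm tree_lang t"
  and wf_tm_child_tm [simp]: "wf_tm tree_lang (child_tm n t) = wf_tm tree_lang t"
  by (simp_all add: parent_tm_def child_tm_def tree_lang_def)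

lemma wf_tm_parent_pow [simp]: "wf_tm tree_lang ((parent_tm ^^ k) t) = wf_tm tree_lang t"
  by (induction k) auto

lemmas connective_simps =
  sat_CConj sat_CDisj wf_fm_CConj wf_fm_CDisj free_vars_CConj free_vars_CDisj

lemma sat_is_child: "sat B (is_child n t) v \<longleftrightarrow>
    child B n (parent B (tm_val B v t)) = tm_val B v t"
  by (simp add: is_child_def)

lemma sat_trunk_sentence: "sat B trunk_sentence v \<longleftrightarrow> has_trunk B"
  unfolding trunk_sentence_def has_trunk_def on_trunk_def
  by (simp add: connective_simps sat_is_child del: sat.simps(4,5))

lemma sat_axioms_sentence: "sat B axioms_sentence v \<longleftrightarrow> tree_axioms B"
proof -
  have "sat B axioms_sentence v \<longleftrightarrow> (\<forall>\<phi>\<in>axiom_set. sat B \<phi> v)"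
    by (simp add: axioms_sentence_def connective_simps countable_axiom_set del: sat.simps)
  also have "\<dots> \<longleftrightarrow> tree_axioms B"
    unfolding axiom_set_def tree_axioms_def on_trunk_def
    by (simp add: connective_simps sat_is_child ball_Un bex_Un del: sat.simps(4,5) funpow.simps)
      ((rule arg_cong2[of _ _ _ _ "(\<and>)"])+; blast)
  finally show ?thesis .
qed

lemma sentence_trunk_sentence: "sentence tree_lang trunk_sentence"
  unfolding trunk_sentence_def sentence_def is_child_def
  by (simp add: connective_simps del: wf_fm.simps(4,5) free_vars.simps(4,5))

lemma sentence_axioms_sentence: "sentence tree_lang axioms_sentence"
proof -
  have "wf_fm tree_lang \<phi> \<and> free_vars \<phi> = {}" if "\<phi> \<in> axiom_set" for \<phi>
    using that unfolding axiom_set_def is_child_def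
    by (auto simp: connective_simps simp del: wf_fm.simps(4,5) free_vars.simps(4,5) funpow.simps)
  then show ?thesis
    unfolding axioms_sentence_def sentence_def
    by (auto simp: connective_simps countable_axiom_set
        simp del: wf_fm.simps(4,5) free_vars.simps(4,5))
qed

lemma Sigma0_1_CDisj_qf:
  assumes "countable S" "\<And>\<phi>. \<phi> \<in> S \<Longrightarrow> fin_qf \<phi>"
  shows "Sigma0 1 (CDisj (acset S))"
proof (rule Sigma0_pos)
  show "\<forall>\<psi>\<in>rcset (acset S). \<exists>xs \<phi> m. m < 1 \<and> Pi0 m \<phi> \<and> \<psi> = foldr Exi xs \<phi>"
    using assms by (auto simp: Pi0_0_iff intro!: exI[of _ "[]"])
qed simp

lemma Pi0_1_CConj_qf:
  assumes "countable S" "\<And>\<phi>. \<phi> \<in> S \<Longrightarrow> fin_qf \<phi>"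
  shows "Pi0 1 (CConj (acset S))"
proof (rule Pi0_pos)
  show "\<forall>\<psi>\<in>rcset (acset S). \<exists>xs \<phi> m. m < 1 \<and> Sigma0 m \<phi> \<and> \<psi> = foldr Uni xs \<phi>"
    using assms by (auto simp: Sigma0_0_iff intro!: exI[of _ "[]"])
qed simp

lemma Sigma2_trunk_sentence: "Sigma0 2 trunk_sentence"
  unfolding trunk_sentence_def
proof (rule Sigma0_pos)
  let ?\<phi> = "CConj (acset (range (\<lambda>n. Neg (is_child n (Var 0)))))"
  have "Pi0 1 ?\<phi>"
    by (rule Pi0_1_CConj_qf) (auto simp: is_child_def intro: fin_qf.intros)
  then show "\<forall>\<psi>\<in>rcset (acset {Exi 0 ?\<phi>}). \<exists>xs \<phi> m. m < 2 \<and> Pi0 m \<phi> \<and> \<psi> = foldr Exi xs \<phi>"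
    by (auto simp: intro!: exI[of _ "[0]"] exI[of _ 1])
qed simp

lemma Pi2_axioms_sentence: "Pi0 2 axioms_sentence"
  unfolding axioms_sentence_def
proof (rule Pi0_pos)
  have u1: "\<exists>xs \<chi> m. m < 2 \<and> Sigma0 m \<chi> \<and> Uni 0 \<phi> = foldr Uni xs \<chi>"
    if "Sigma0 0 \<phi> \<or> Sigma0 1 \<phi>" for \<phi>
    using that by (intro exI[of _ "[0]"] exI[of _ \<phi>]) (auto intro: exI[of _ 0] exI[of _ 1])
  have u2: "\<exists>xs \<chi> m. m < 2 \<and> Sigma0 m \<chi> \<and> Uni 0 (Uni 1 \<phi>) = foldr Uni xs \<chi>"
    if "Sigma0 1 \<phi>" for \<phi>
    using that by (intro exI[of _ "[0, 1]"] exI[of _ \<phi>]) (auto intro: exI[of _ 1])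
  have "\<exists>xs \<chi> m. m < 2 \<and> Sigma0 m \<chi> \<and> \<psi> = foldr Uni xs \<chi>" if "\<psi> \<in> axiom_set" for \<psi>
    using that unfolding axiom_set_def is_child_def
    by (elim UnE imageE insertE emptyE; simp only: split_paired_all prod.case)
      (rule u1 u2; (rule disjI1, force simp: Sigma0_0_iff intro: fin_qf.intros)?;
       (rule disjI2)?; rule Sigma0_1_CDisj_qf; force intro: fin_qf.intros)+
  then show "\<forall>\<psi>\<in>rcset (acset axiom_set).
      \<exists>xs \<phi> m. m < 2 \<and> Sigma0 m \<phi> \<and> \<psi> = foldr Uni xs \<phi>"
    by (simp add: countable_axiom_set)
qed simp

lemma quasi_scott_sentence_tree:
  "\<exists>\<theta>. dSigma0 2 \<theta> \<and> quasi_scott_sentence tree_lang (tree {0..}) \<theta>"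
proof (intro exI conjI)
  let ?\<Phi> = "cinsert trunk_sentence (cinsert axioms_sentence cempty)"
  show "dSigma0 2 (CConj ?\<Phi>)"
    unfolding dSigma0_def using Sigma2_trunk_sentence Pi2_axioms_sentence by blast
  have rc: "rcset ?\<Phi> = {trunk_sentence, axioms_sentence}"
    by (simp add: cinsert.rep_eq bot_cset.rep_eq)
  have sat: "sat B (CConj ?\<Phi>) v \<longleftrightarrow> has_trunk B \<and> tree_axioms B" for B :: "nat struct" and v
    by (simp add: sat_CConj rc sat_trunk_sentence sat_axioms_sentence del: sat.simps)
  have models: "models B (CConj ?\<Phi>) \<longleftrightarrow> has_trunk B \<and> tree_axioms B"
    if "is_struct tree_lang B" for B :: "nat struct"
  proof -
    \<comment> \<open>\<open>models\<close> quantifies over valuations into the universe, so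
      nonemptiness excludes vacuous truth.\<close>
    have "univ B \<noteq> {}" using that by (simp add: is_struct_def)
    then obtain x where "x \<in> univ B" by blast
    then have "\<exists>v :: nat \<Rightarrow> nat. range v \<subseteq> univ B" by (intro exI[of _ "\<lambda>_. x"]) auto
    then show ?thesis unfolding models_def sat by blast
  qed
  show "quasi_scott_sentence tree_lang (tree {0..}) (CConj ?\<Phi>)"
    unfolding quasi_scott_sentence_def
  proof (intro conjI allI impI)
    show "sentence tree_lang (CConj ?\<Phi>)"
      using sentence_trunk_sentence sentence_axioms_sentence
      by (simp add: sentence_def wf_fm_CConj free_vars_CConj rc del: wf_fm.simps free_vars.simps)
    show "models (tree {0..}) (CConj ?\<Phi>)"
      using models[OF is_struct_tree_atLeast] has_trunk_tree tree_axioms_tree by blast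
    fix B :: "nat struct"
    assume "is_struct tree_lang B" "finitely_generated tree_lang B" "models B (CConj ?\<Phi>)"
    then show "isomorphic tree_lang (tree {0..}) B"
      using models isomorphic_treeI by blast
  qed
qed

theorem theorem5p14:
  shows "\<exists>(L :: lang) (A :: nat struct).
    is_struct L A \<and> finitely_generated L A \<and>
    \<not> (\<exists>\<phi>. dSigma0 2 \<phi> \<and> scott_sentence L A \<phi>) \<and>
    (\<exists>\<phi>. dSigma0 2 \<phi> \<and> quasi_scott_sentence L A \<phi>)"
proof (rule exI[of _ tree_lang], rule exI[of _ "tree {0..}"], intro conjI)
  show "is_struct tree_lang (tree {0..})" by (rule is_struct_tree_atLeast)
  show "finitely_generated tree_lang (tree {0..})" by (rule finitely_generated_tree)
  show "\<not> (\<exists>\<phi>. dSigma0 2 \<phi> \<and> scott_sentence tree_lang (tree {0..}) \<phi>)"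
  proof
    assume "\<exists>\<phi>. dSigma0 2 \<phi> \<and> scott_sentence tree_lang (tree {0..}) \<phi>"
    then obtain \<phi> where \<phi>: "dSigma0 2 \<phi>" "scott_sentence tree_lang (tree {0..}) \<phi>" by blast
    \<comment> \<open>A Scott sentence is tested on all countable structures, hence also on
      \<open>tree UNIV\<close>, although that tree is not finitely generated.\<close>
    then have "models (tree UNIV) \<phi>"
      by (intro dSigma2_tree_UNIV) (simp_all add: scott_sentence_def)
    then have "isomorphic tree_lang (tree {0..}) (tree UNIV)"
      using \<phi>(2) is_struct_tree_UNIV unfolding scott_sentence_def by simp
    then show False using not_isomorphic_tree_UNIV by contradiction
  qed
qed (rule quasi_scott_sentence_tree)

end
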